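(* Let $N,M$ be positive integers, let $\mathcal A,\mathcal M\in\mathbb C^{N\times N}$ with $\mathcal A$ Hermitian positive semi-definite and $\mathcal M$ Hermitian positive definite, let $\mathcal B\in\mathbb C^{N\times M}$ satisfy $\mathcal A\mathcal M^{-1}\mathcal B=0$, let $\mathcal U\in\mathbb C^{M\times M}$ be Hermitian positive definite, let $\mathcal F\in\mathbb C^N$ and let $0\neq\mathcal G\in\operatorname{Im}\mathcal B^*\subset\mathbb C^M$. Suppose $\dim\mathbb C_0=0$. Then the constrained system $$\mathcal A u+\mathcal B p=\mathcal F,\qquad \mathcal B^* u=\mathcal G\qquad (u\in\mathbb C^N,\ p\in\mathbb C^M)$$ has a solution $(u,p)$ whose component $u$ is unique, and this $u$ is obtained as follows: there is a unique $\tilde u\in\mathbb C^N$ with $$(\mathcal A+\mathcal B\mathcal U\mathcal B^* )\tilde u=\mathcal F,$$ and then $u$ is the unique solution in $\mathbb C^N$ of $$(\mathcal A+\mathcal B\mathcal U\mathcal B^* )u=\mathcal F-\mathcal B\mathcal U\mathcal B^*\tilde u+\mathcal B\mathcal U\mathcal G.$$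
   Context: $X^*$ denotes the conjugate transpose of a matrix $X$. $\mathbb C_0:=\operatorname{Ker}\mathcal A\cap\operatorname{Ker}(\mathcal B\mathcal U\mathcal B^* )\subset\mathbb C^N$. *)

theory Defs
  imports "HOL-Analysis.Analysis"
begin

text \<open>
  A matrix in \<open>\<complex>\<^bsup>N\<times>M\<^esup>\<close> (\<open>N\<close> rows, \<open>M\<close> columns) has type \<^typ>\<open>complex^'m^'n\<close>, where
  \<open>N = CARD('n)\<close> and \<open>M = CARD('m)\<close>. Since HOL types are nonempty, \<open>N, M \<ge> 1\<close>.
\<close>

definition conj_transpose :: "complex^'m^'n \<Rightarrow> complex^'n^'m" where
  "conj_transpose X = (\<chi> i j. cnj (X $ j $ i))"

definition hermitian :: "complex^'n^'n \<Rightarrow> bool" where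
  "hermitian X \<longleftrightarrow> conj_transpose X = X"

text \<open>
  \<open>quad_form X x = x\<^sup>* X x\<close>. The class instance \<open>\<bullet>\<close> on \<^typ>\<open>complex^'n\<close> is the real inner product,
  so the complex form is spelled out. It is real-valued when \<open>X\<close> is Hermitian, which is why
  only its real part occurs in the two notions of positivity.
\<close>

definition quad_form :: "complex^'n^'n \<Rightarrow> complex^'n \<Rightarrow> complex" where
  "quad_form X x = (\<Sum>i\<in>UNIV. cnj (x $ i) * (X *v x) $ i)"

definition hermitian_psd :: "complex^'n^'n \<Rightarrow> bool" where
  "hermitian_psd X \<longleftrightarrow> hermitian X \<and> (\<forall>x. Re (quad_form X x) \<ge> 0)"

definition hermitian_pd :: "complex^'n^'n \<Rightarrow> bool" where
  "hermitian_pd X \<longleftrightarrow> hermitian X \<and> (\<forall>x. x \<noteq> 0 \<longrightarrow> Re (quad_form X x) > 0)"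

definition mat_ker :: "complex^'m^'n \<Rightarrow> (complex^'m) set" where
  "mat_ker X = {x. X *v x = 0}"

definition mat_im :: "complex^'m^'n \<Rightarrow> (complex^'n) set" where
  "mat_im X = range (\<lambda>x. X *v x)"

definition C0 :: "complex^'n^'n \<Rightarrow> complex^'m^'n \<Rightarrow> complex^'m^'m \<Rightarrow> (complex^'n) set" where
  "C0 A B U = mat_ker A \<inter> mat_ker (B ** U ** conj_transpose B)"

definition solves_constrained ::
  "complex^'n^'n \<Rightarrow> complex^'m^'n \<Rightarrow> complex^'n \<Rightarrow> complex^'m \<Rightarrow> complex^'n \<Rightarrow> complex^'m \<Rightarrow> bool" where
  "solves_constrained A B F G u p \<longleftrightarrow> A *v u + B *v p = F \<and> conj_transpose B *v u = G"

end

theory Submission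
  imports Defs
begin

text \<open>
  Write \<open>K = A + B U B\<^sup>*\<close>. A vector \<open>x\<close> in the kernel of \<open>K\<close> makes both \<open>x\<^sup>* A x\<close> and
  \<open>(B\<^sup>* x)\<^sup>* U (B\<^sup>* x)\<close> vanish, hence lies in \<open>C0\<close>, so \<open>K\<close> is invertible. Since
  \<open>A M\<^sup>-\<^sup>1 B = 0\<close>, we have \<open>K M\<^sup>-\<^sup>1 B = B U B\<^sup>* M\<^sup>-\<^sup>1 B\<close>, so
  \<open>B\<^sup>* K\<^sup>-\<^sup>1 B U\<close> is the identity on the image of \<open>B\<^sup>* M\<^sup>-\<^sup>1 B\<close>, and this image is all of \<open>Im B\<^sup>*\<close>
  because \<open>M\<^sup>-\<^sup>1\<close> is definite. Therefore the vector \<open>u\<close> given by the formula satisfies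
  \<open>B\<^sup>* u = B\<^sup>* ut - B\<^sup>* ut + G = G\<close>, and \<open>p = U B\<^sup>* ut\<close> is a matching multiplier.

  All orthogonality arguments use the real inner product \<open>Re (x\<^sup>* y)\<close> of the class instance, for
  which the conjugate transpose is again the adjoint.
\<close>

lemma inner_conj_transpose:
  fixes X :: "complex^'m^'n"
  shows "(conj_transpose X *v y) \<bullet> x = y \<bullet> (X *v x)"
proof -
  have "(conj_transpose X *v y) \<bullet> x = (\<Sum>i\<in>UNIV. \<Sum>j\<in>UNIV. (cnj (X$j$i) * y$j) \<bullet> x$i)"
    by (simp add: inner_vec_def matrix_vector_mult_def conj_transpose_def inner_sum_left)
  also have "\<dots> = (\<Sum>j\<in>UNIV. \<Sum>i\<in>UNIV. y$j \<bullet> (X$j$i * x$i))"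
    by (subst sum.swap) (simp add: inner_complex_def algebra_simps)
  also have "\<dots> = y \<bullet> (X *v x)"
    by (simp add: inner_vec_def matrix_vector_mult_def inner_sum_right)
  finally show ?thesis .
qed

lemma Re_quad_form: "Re (quad_form X x) = x \<bullet> (X *v x)"
  by (simp add: quad_form_def inner_vec_def inner_complex_def)

lemma hermitian_inner: "hermitian X \<Longrightarrow> (X *v y) \<bullet> x = y \<bullet> (X *v x)"
  using inner_conj_transpose[of X y x] by (simp add: hermitian_def)

lemma hermitian_pd_inner_eq_0:
  assumes "hermitian_pd X"
  shows "x \<bullet> (X *v x) = 0 \<longleftrightarrow> x = 0"
  using assms unfolding hermitian_pd_def Re_quad_form by (metis inner_zero_left less_irrefl)

lemma hermitian_pd_inner_nonneg:
  assumes "hermitian_pd X"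
  shows "x \<bullet> (X *v x) \<ge> 0"
  using assms unfolding hermitian_pd_def Re_quad_form by (cases "x = 0") (auto simp: less_imp_le)

lemma invertible_if_trivial_kernel:
  fixes X :: "'a::field^'n^'n"
  assumes "\<And>x. X *v x = 0 \<Longrightarrow> x = 0"
  shows "invertible X"
  using assms invertible_left_inverse matrix_left_invertible_ker by blast

lemma matrix_inv_right:
  assumes "invertible X"
  shows "X ** matrix_inv X = mat 1"
  using someI_ex[OF assms[unfolded invertible_def]] by (simp add: matrix_inv_def)

lemma matrix_inv_left:
  assumes "invertible X"
  shows "matrix_inv X ** X = mat 1"
  using someI_ex[OF assms[unfolded invertible_def]] by (simp add: matrix_inv_def)

lemma ex1_solution_if_invertible:
  fixes X :: "'a::field^'n^'n"
  assumes "invertible X"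
  shows "\<exists>!x. X *v x = y"
proof -
  have "X *v (matrix_inv X *v y) = y"
    using matrix_inv_right[OF assms] by (simp add: matrix_vector_mul_assoc)
  moreover have "x = matrix_inv X *v y" if "X *v x = y" for x
    using matrix_inv_left[OF assms] that by (metis matrix_vector_mul_assoc matrix_vector_mul_lid)
  ultimately show ?thesis by blast
qed

lemma hermitian_pd_invertible: "hermitian_pd X \<Longrightarrow> invertible X"
  by (rule invertible_if_trivial_kernel) (metis hermitian_pd_inner_eq_0 inner_zero_right)

text \<open>Substituting \<open>x = X y\<close> with \<open>y = matrix_inv X *v x\<close> turns the
  form into \<open>y \<bullet> (X *v y)\<close>, so definiteness of \<open>X\<close> itself
  suffices.\<close>

lemma hermitian_pd_inv_inner_eq_0:
  assumes "hermitian_pd X" and "(matrix_inv X *v x) \<bullet> x = 0"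
  shows "x = 0"
proof -
  have x: "X *v (matrix_inv X *v x) = x"
    using matrix_inv_right[OF hermitian_pd_invertible[OF assms(1)]]
    by (simp add: matrix_vector_mul_assoc)
  then have "matrix_inv X *v x = 0"
    using assms hermitian_pd_inner_eq_0 by metis
  then show "x = 0"
    using x by simp
qed

lemma mat_im_conj_transpose_subset:
  fixes B :: "complex^'m^'n"
  assumes "hermitian_pd M"
  shows "mat_im (conj_transpose B) \<subseteq> mat_im (conj_transpose B ** matrix_inv M ** B)"
proof
  fix G assume "G \<in> mat_im (conj_transpose B)"
  then obtain g where g: "G = conj_transpose B *v g"
    by (auto simp: mat_im_def)
  define S where "S = conj_transpose B ** matrix_inv M ** B"
  have S: "S *v q = conj_transpose B *v (matrix_inv M *v (B *v q))" for q
    by (simp add: S_def matrix_vector_mul_assoc matrix_mul_assoc)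
  have "linear ((*v) S)"
    by (rule Finite_Cartesian_Product.matrix_vector_mul_linear)
  \<comment> \<open>The decomposition theorem speaks of a span; the range is already a subspace, so
    the component \<open>y\<close> lies in the range itself.\<close>
  then have "span (range ((*v) S)) = range ((*v) S)"
    by (metis linear_subspace_image span_eq_iff subspace_UNIV)
  then obtain y z where y: "y \<in> range ((*v) S)"
    and z: "\<And>w. w \<in> range ((*v) S) \<Longrightarrow> orthogonal z w" and G: "G = y + z"
    using orthogonal_subspace_decomp_exists[of "range ((*v) S)" G] by metis
  from y obtain q where q: "y = S *v q"
    by blast
  \<comment> \<open>Testing \<open>z\<close> against \<open>S *v z\<close>, which lies in the range,
    yields the form of \<open>matrix_inv M\<close> at \<open>B *v z\<close>.\<close>
  have "0 = (S *v z) \<bullet> z"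
    using z[of "S *v z"] by (simp add: orthogonal_def inner_commute)
  also have "\<dots> = (matrix_inv M *v (B *v z)) \<bullet> (B *v z)"
    by (simp add: S inner_conj_transpose)
  finally have Bz: "B *v z = 0"
    using hermitian_pd_inv_inner_eq_0[OF assms, of "B *v z"] by simp
  \<comment> \<open>As \<open>G - S *v q\<close>, the remainder \<open>z\<close> is in the image of
    the adjoint of \<open>B\<close>, hence orthogonal to the kernel of \<open>B\<close>, where it
    also lies.\<close>
  have "z = conj_transpose B *v (g - matrix_inv M *v (B *v q))"
    using G g q by (simp add: S matrix_vector_mult_diff_distrib)
  then have "z \<bullet> z = (g - matrix_inv M *v (B *v q)) \<bullet> (B *v z)"
    by (metis inner_conj_transpose)
  then have "z = 0"
    using Bz by simp
  then show "G \<in> mat_im (conj_transpose B ** matrix_inv M ** B)"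
    using G q by (auto simp: mat_im_def S_def)
qed

lemma augmented_invertible:
  assumes "hermitian_psd A" and "hermitian_pd U" and "C0 A B U \<subseteq> {0}"
  shows "invertible (A + B ** U ** conj_transpose B)"
proof (rule invertible_if_trivial_kernel)
  fix x assume Kx: "(A + B ** U ** conj_transpose B) *v x = 0"
  define y where "y = conj_transpose B *v x"
  have split: "A *v x + B *v (U *v y) = 0"
    using Kx by (simp add: y_def matrix_vector_mult_add_rdistrib matrix_vector_mul_assoc matrix_mul_assoc)
  have "x \<bullet> (A *v x) + y \<bullet> (U *v y) = x \<bullet> (A *v x + B *v (U *v y))"
    by (simp add: y_def inner_conj_transpose inner_add_right)
  moreover have "x \<bullet> (A *v x) \<ge> 0"
    using assms(1) by (simp add: hermitian_psd_def Re_quad_form)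
  moreover have "y \<bullet> (U *v y) \<ge> 0"
    using assms(2) by (rule hermitian_pd_inner_nonneg)
  ultimately have "y \<bullet> (U *v y) = 0"
    using split by simp
  then have y: "y = 0"
    using hermitian_pd_inner_eq_0[OF assms(2)] by blast
  \<comment> \<open>With \<open>y = 0\<close> the kernel equation itself reduces to this.\<close>
  then have "A *v x = 0"
    using split by simp
  moreover have "(B ** U ** conj_transpose B) *v x = 0"
    using y by (simp add: y_def flip: matrix_vector_mul_assoc)
  ultimately show "x = 0"
    using assms(3) by (auto simp: C0_def mat_ker_def)
qed

text \<open>The hypothesis \<open>A M\<^sup>-\<^sup>1 B = 0\<close> makes the ranges of \<open>A\<close> and \<open>B\<close> orthogonal with respect to the
  form \<open>x\<^sup>* M\<^sup>-\<^sup>1 y\<close>.\<close>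

lemma range_intersection_trivial:
  assumes "hermitian A" and "hermitian_pd M" and "A ** matrix_inv M ** B = 0"
    and "A *v w + B *v q = 0"
  shows "B *v q = 0"
proof (rule hermitian_pd_inv_inner_eq_0[OF assms(2)])
  have "A *v (matrix_inv M *v (B *v q)) = 0"
    using assms(3) by (simp add: matrix_vector_mul_assoc matrix_mul_assoc)
  then have "(matrix_inv M *v (B *v q)) \<bullet> (A *v w) = 0"
    using hermitian_inner[OF assms(1), of "matrix_inv M *v (B *v q)" w] by simp
  moreover have "B *v q = - (A *v w)"
    using assms(4) by (simp add: eq_neg_iff_add_eq_0 add.commute)
  ultimately show "(matrix_inv M *v (B *v q)) \<bullet> (B *v q) = 0"
    by simp
qed

text \<open>Applied to the difference of two solutions, the trivial intersection of the ranges
  separates the first equation; only \<open>B *v p\<close> is pinned down, not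
  \<open>p\<close>.\<close>

lemma constrained_solution_unique:
  assumes "hermitian A" and "hermitian_pd M" and "A ** matrix_inv M ** B = 0"
    and "C0 A B U \<subseteq> {0}"
    and "solves_constrained A B F G u p" and "solves_constrained A B F G u' p'"
  shows "u' = u"
proof -
  have eq: "A *v (u' - u) + B *v (p' - p) = 0" and Bu: "conj_transpose B *v (u' - u) = 0"
    using assms(5,6) by (auto simp: solves_constrained_def matrix_vector_mult_diff_distrib
        algebra_simps)
  have "B *v (p' - p) = 0"
    using range_intersection_trivial[OF assms(1-3) eq] .
  then have "A *v (u' - u) = 0"
    using eq by simp
  moreover have "(B ** U ** conj_transpose B) *v (u' - u) = 0"
    using Bu by (simp flip: matrix_vector_mul_assoc)
  ultimately show ?thesis
    using assms(4) by (auto simp: C0_def mat_ker_def)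
qed

lemma augmented_solves_constrained:
  assumes "hermitian_pd M" and "A ** matrix_inv M ** B = 0"
    and G: "G \<in> mat_im (conj_transpose B)"
    and inv: "invertible (A + B ** U ** conj_transpose B)"
    and ut: "(A + B ** U ** conj_transpose B) *v ut = F"
    and u: "(A + B ** U ** conj_transpose B) *v u
              = F - (B ** U ** conj_transpose B) *v ut + (B ** U) *v G"
  shows "solves_constrained A B F G u (U *v (conj_transpose B *v ut))"
proof -
  let ?K = "A + B ** U ** conj_transpose B"
  have K: "?K *v x = A *v x + B *v (U *v (conj_transpose B *v x))" for x
    by (simp add: matrix_vector_mult_add_rdistrib matrix_vector_mul_assoc matrix_mul_assoc)
  obtain g where g: "G = conj_transpose B *v g"
    using G by (auto simp: mat_im_def)
  have "conj_transpose B *v (g - ut) \<in> mat_im (conj_transpose B)"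
    by (simp add: mat_im_def)
  \<comment> \<open>This \<open>q\<close> yields a correction \<open>v\<close> in the kernel of
    \<open>A\<close> that moves the constraint value of \<open>ut\<close> to \<open>G\<close>; then
    \<open>ut + v\<close> solves the equation defining \<open>u\<close>.\<close>
  then obtain q where q:
    "conj_transpose B *v (g - ut) = conj_transpose B *v (matrix_inv M *v (B *v q))"
    using mat_im_conj_transpose_subset[OF assms(1), of B]
    by (force simp: mat_im_def matrix_vector_mul_assoc matrix_mul_assoc)
  define v where "v = matrix_inv M *v (B *v q)"
  have "A *v v = 0"
    using assms(2) by (simp add: v_def matrix_vector_mul_assoc matrix_mul_assoc)
  then have "?K *v (ut + v) = F + B *v (U *v (conj_transpose B *v (g - ut)))"
    using ut q by (simp add: v_def matrix_vector_right_distrib K)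
  also have "\<dots> = ?K *v u"
    unfolding u g
    by (simp add: matrix_vector_mult_diff_distrib algebra_simps flip: matrix_vector_mul_assoc)
  finally have "u = ut + v"
    using ex1_solution_if_invertible[OF inv] by metis
  then have Bu: "conj_transpose B *v u = G"
    using q g by (simp add: v_def[symmetric] matrix_vector_right_distrib
        matrix_vector_mult_diff_distrib diff_eq_eq add.commute)
  \<comment> \<open>Once the constraint holds, the term with \<open>G\<close> cancels on both sides
    of \<open>u\<close>, and what remains shows the multiplier.\<close>
  moreover have "A *v u + B *v (U *v (conj_transpose B *v ut)) = F"
    using u Bu unfolding K
    by (simp add: algebra_simps flip: matrix_vector_mul_assoc)
  ultimately show ?thesis
    by (simp add: solves_constrained_def)
qed

theorem mainTheorem10:
  fixes A M :: "complex^'n^'n"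
    and B :: "complex^'m^'n"
    and U :: "complex^'m^'m"
    and F :: "complex^'n"
    and G :: "complex^'m"
  assumes "hermitian_psd A"
    and "hermitian_pd M"
    and "A ** matrix_inv M ** B = 0"
    and "hermitian_pd U"
    and "G \<noteq> 0"
    and "G \<in> mat_im (conj_transpose B)"
    and "vec.dim (C0 A B U) = 0"
  shows "\<exists>u. (\<exists>p. solves_constrained A B F G u p)
           \<and> (\<forall>u' p'. solves_constrained A B F G u' p' \<longrightarrow> u' = u)
           \<and> (\<exists>!ut. (A + B ** U ** conj_transpose B) *v ut = F)
           \<and> (\<forall>ut. (A + B ** U ** conj_transpose B) *v ut = F \<longrightarrow>
                (A + B ** U ** conj_transpose B) *v u
                  = F - (B ** U ** conj_transpose B) *v ut + (B ** U) *v G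
              \<and> (\<forall>v. (A + B ** U ** conj_transpose B) *v v
                  = F - (B ** U ** conj_transpose B) *v ut + (B ** U) *v G \<longrightarrow> v = u))"
proof -
  let ?K = "A + B ** U ** conj_transpose B"
  \<comment> \<open>\<open>vec.dim\<close> is the dimension over the complex field.\<close>
  have C0: "C0 A B U \<subseteq> {0}"
    using assms(7) by (simp add: vec.dim_eq_0)
  have A: "hermitian A"
    using assms(1) by (simp add: hermitian_psd_def)
  have inv: "invertible ?K"
    using augmented_invertible[OF assms(1,4) C0] .
  note ex1 = ex1_solution_if_invertible[OF inv]
  obtain ut where ut: "?K *v ut = F"
    using ex1 by metis
  obtain u where u: "?K *v u = F - (B ** U ** conj_transpose B) *v ut + (B ** U) *v G"
    using ex1 by metis
  have sol: "solves_constrained A B F G u (U *v (conj_transpose B *v ut))"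
    using augmented_solves_constrained[OF assms(2,3,6) inv ut u] .
  show ?thesis
  proof (intro exI[of _ u] conjI allI impI)
    show "\<exists>p. solves_constrained A B F G u p"
      using sol by blast
    show "u' = u" if "solves_constrained A B F G u' p'" for u' p'
      using constrained_solution_unique[OF A assms(2,3) C0 sol that] .
    show "\<exists>!ut. ?K *v ut = F"
      by (rule ex1)
    \<comment> \<open>Invertibility identifies \<open>ut'\<close> with the vector from which
      \<open>u\<close> was built.\<close>
    fix ut' assume "?K *v ut' = F"
    then have "ut' = ut"
      using ut ex1 by metis
    then show *: "?K *v u = F - (B ** U ** conj_transpose B) *v ut' + (B ** U) *v G"
      using u by simp
    show "v = u" if "?K *v v = F - (B ** U ** conj_transpose B) *v ut' + (B ** U) *v G" for v
      using that * ex1 by metis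
  qed
qed

end
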